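(* Let $Y$ be a Young tableau with degree $d$ and dimension $n$. Then $$[Y]^c=\begin{cases}\langle DT(Y)\rangle,&\text{if } d\text{ is even};\\ \{DT(Y)\},&\text{if } d\text{ is odd},\end{cases}$$ that is, $[Y]^c=\sum_{\sigma_2,\dots,\sigma_d\in S_n}\mathrm{sign}(\sigma_2)\cdots\mathrm{sign}(\sigma_d)\,\langle Y_{\mathrm{id},\sigma_2,\dots,\sigma_d}\rangle$ if $d$ is even, and the same formula with $\{Y_{\mathrm{id},\sigma_2,\dots,\sigma_d}\}$ in place of $\langle Y_{\mathrm{id},\sigma_2,\dots,\sigma_d}\rangle$ if $d$ is odd.
   Context: Let $\mathbb K$ be a field with $\mathrm{char}(\mathbb K)\ne2$, $m\ge n$, and let $\mathbf a_i=(x_{i1},\dots,x_{in})^T$, $i=1,\dots,m$, be vectors whose coordinates are variables of the polynomial ring $\mathbb K[x_{ij}]$. A Young tableau of degree $d$ and dimension $n$ is a $d\times n$ array $Y=(\mathbf y_{ij})$ with entries in $\{\mathbf a_1,\dots,\mathbf a_m\}$. The bracket monomial $[Y]$ is the product over the rows $i=1,\dots,d$ of the brackets $[\mathbf y_{i1}\cdots\mathbf y_{in}]$, and $[Y]^c=\prod_{i=1}^d\det(\mathbf y_{i1},\dots,\mathbf y_{in})\in\mathbb K[x_{ij}]$ is its expansion in coordinates. Let $\odot$ be the Hadamard (entrywise) product of vectors and let $H$ be the $n\times n$ matrix whose $j$-th column is $\mathbf y_{1j}\odot\cdots\odot\mathbf y_{dj}$. The even dual bracket is $\langle Y\rangle:=\mathrm{perm}(H)$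 (the permanent) and the odd dual bracket is $\{Y\}:=\det(H)$. Both are extended linearly to formal linear combinations of tableaux. For a row $\mathbf R=(\mathbf r_1,\dots,\mathbf r_n)$ and $\sigma\in S_n$ let $\sigma(\mathbf R)=(\mathbf r_{\sigma(1)},\dots,\mathbf r_{\sigma(n)})$. If $Y$ has rows $\mathbf R_1,\dots,\mathbf R_d$, then $Y_{\sigma_1,\dots,\sigma_d}$ is the tableau with rows $\sigma_1(\mathbf R_1),\dots,\sigma_d(\mathbf R_d)$. The dual tableau polynomial of $Y$ is the formal linear combination $$DT(Y):=\sum_{\sigma_2,\dots,\sigma_d\in S_n}\mathrm{sign}(\sigma_2)\cdots\mathrm{sign}(\sigma_d)\,Y_{\mathrm{id},\sigma_2,\dots,\sigma_d}.$$ *)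

theory Defs
  imports
    "HOL-Analysis.Determinants"
    "HOL-Library.Poly_Mapping"
    "HOL-Computational_Algebra.Factorial_Ring"
begin

text \<open>
  The polynomial ring over \<open>'k\<close> in the variables \<open>x\<^sub>i\<^sub>j\<close>, with \<open>i\<close> in the index type
  \<open>'m\<close> of the generic vectors and \<open>j\<close> in the index type \<open>'n\<close> of their coordinates:
  finitely supported maps from monomials (exponent functions) to coefficients.
\<close>

type_synonym ('k, 'm, 'n) coord_poly = "('m \<times> 'n \<Rightarrow>\<^sub>0 nat) \<Rightarrow>\<^sub>0 'k"

definition const_poly :: "'k::field \<Rightarrow> ('k, 'm, 'n) coord_poly" where
  "const_poly c = Poly_Mapping.single 0 c"

definition coord_var :: "'m \<Rightarrow> 'n \<Rightarrow> ('k::field, 'm, 'n) coord_poly" where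
  "coord_var i j = Poly_Mapping.single (Poly_Mapping.single (i, j) 1) 1"

definition generic_vec :: "'m \<Rightarrow> ('k::field, 'm, 'n::finite) coord_poly ^ 'n" where
  "generic_vec i = (\<chi> j. coord_var i j)"

text \<open>
  A row \<open>R\<close> is an \<open>'n\<close>-tuple of vectors, \<open>R $ j\<close> being the vector in column \<open>j\<close> (so
  \<open>R $ j $ k\<close> is the \<open>k\<close>-th coordinate of that vector); an array is the list of its rows.
\<close>

type_synonym ('a, 'n) row = "('a ^ 'n) ^ 'n"
type_synonym ('a, 'n) array = "('a, 'n) row list"

definition young_tableau :: "nat \<Rightarrow> (('k::field, 'm, 'n::finite) coord_poly, 'n) array \<Rightarrow> bool" where
  "young_tableau d Y \<longleftrightarrow> length Y = d \<and> (\<forall>R\<in>set Y. \<forall>j. R $ j \<in> range generic_vec)"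

definition bracket :: "('a::comm_ring_1, 'n::finite) row \<Rightarrow> 'a" where
  "bracket R = det (\<chi> k j. R $ j $ k)"

definition bracket_expansion :: "('a::comm_ring_1, 'n::finite) array \<Rightarrow> 'a" where
  "bracket_expansion Y = (\<Prod>R\<leftarrow>Y. bracket R)"

definition permanent :: "'a::comm_ring_1 ^ 'n ^ 'n::finite \<Rightarrow> 'a" where
  "permanent A = (\<Sum>p | p permutes UNIV. \<Prod>i\<in>UNIV. A $ i $ p i)"

text \<open>Multiplication on the type \<^typ>\<open>'a ^ 'n\<close> is entrywise, i.e. the Hadamard product.\<close>

definition hadamard_column :: "('a::comm_ring_1, 'n::finite) array \<Rightarrow> 'n \<Rightarrow> 'a ^ 'n" where
  "hadamard_column Y j = (\<Prod>R\<leftarrow>Y. R $ j)"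

definition hadamard_matrix :: "('a::comm_ring_1, 'n::finite) array \<Rightarrow> 'a ^ 'n ^ 'n" where
  "hadamard_matrix Y = (\<chi> k j. hadamard_column Y j $ k)"

definition even_dual_bracket :: "('a::comm_ring_1, 'n::finite) array \<Rightarrow> 'a" where
  "even_dual_bracket Y = permanent (hadamard_matrix Y)"

definition odd_dual_bracket :: "('a::comm_ring_1, 'n::finite) array \<Rightarrow> 'a" where
  "odd_dual_bracket Y = det (hadamard_matrix Y)"

text \<open>
  Formal linear combinations of objects of type \<open>'t\<close> over \<open>'k\<close> are elements of
  \<^typ>\<open>'t \<Rightarrow>\<^sub>0 'k\<close>.
\<close>

definition linear_extension ::
    "('t \<Rightarrow> ('k::field, 'm, 'n) coord_poly) \<Rightarrow> ('t \<Rightarrow>\<^sub>0 'k) \<Rightarrow> ('k, 'm, 'n) coord_poly" where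
  "linear_extension f c =
     (\<Sum>t\<in>Poly_Mapping.keys c. const_poly (Poly_Mapping.lookup c t) * f t)"

definition permute_row :: "('n \<Rightarrow> 'n) \<Rightarrow> ('a, 'n::finite) row \<Rightarrow> ('a, 'n) row" where
  "permute_row \<sigma> R = (\<chi> j. R $ \<sigma> j)"

definition permute_rows :: "('n \<Rightarrow> 'n) list \<Rightarrow> ('a, 'n::finite) array \<Rightarrow> ('a, 'n) array" where
  "permute_rows \<sigma>s Y = map2 permute_row \<sigma>s Y"

text \<open>The list \<open>[\<sigma>\<^sub>2, \<dots>, \<sigma>\<^sub>d]\<close> of permutations acting on the rows after the first.\<close>

definition perm_lists :: "nat \<Rightarrow> ('n::finite \<Rightarrow> 'n) list set" where
  "perm_lists d = {\<sigma>s \<in> lists {p. p permutes UNIV}. length \<sigma>s = d - 1}"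

definition sign_list :: "('n::finite \<Rightarrow> 'n) list \<Rightarrow> int" where
  "sign_list \<sigma>s = (\<Prod>\<sigma>\<leftarrow>\<sigma>s. sign \<sigma>)"

definition dual_tableau_poly ::
    "(('k::field, 'm, 'n::finite) coord_poly, 'n) array \<Rightarrow>
     (('k, 'm, 'n) coord_poly, 'n) array \<Rightarrow>\<^sub>0 'k" where
  "dual_tableau_poly Y =
     (\<Sum>\<sigma>s\<in>perm_lists (length Y).
        Poly_Mapping.single (permute_rows (id # \<sigma>s) Y) (of_int (sign_list \<sigma>s)))"

end

theory Submission
  imports Defs
begin

text \<open>
  Write every bracket, permanent and determinant as a sum over permutations. For a
  weight \<open>\<epsilon>\<close> (constantly \<open>1\<close> for the permanent, the sign for the determinant), a dual
  bracket of the array with rows \<open>\<sigma>\<^sub>i(R\<^sub>i)\<close> is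
  \<open>\<Sum>\<^sub>p \<epsilon>(p) \<Prod>\<^sub>i \<Prod>\<^sub>k (R\<^sub>i)\<^bsub>\<sigma>\<^sub>i(p(k)), k\<^esub>\<close>,
  where the second index \<open>k\<close> selects a coordinate of the chosen vector of the row,
  because taking an entry of a Hadamard product is multiplicative in the rows. Now
  exchange the sum over the \<open>\<sigma>\<^sub>i\<close> with the sum over \<open>p\<close>. For fixed \<open>p\<close> the signed sum over
  \<open>(\<sigma>\<^sub>2, \<dots>, \<sigma>\<^sub>d)\<close> splits into a product of independent sums, one for each row after the
  first, and the substitution \<open>\<tau> = \<sigma>\<^sub>i \<circ> p\<close> identifies each of these sums with \<open>sign p\<close> times
  the bracket of \<open>R\<^sub>i\<close> (lemmas \<open>signed_sum_permuted_row\<close> and \<open>signed_sum_permuted_rows\<close>).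
  So all rows but the first have turned into their brackets, at the price of the factor
  \<open>(sign p)\<^bsup>d-1\<^esup>\<close>, and what remains is
  \<open>\<Sum>\<^sub>p \<epsilon>(p) (sign p)\<^bsup>d-1\<^esup> \<Prod>\<^sub>k (R\<^sub>1)\<^bsub>p(k), k\<^esub>\<close>.
  This is the bracket of the first row as soon as \<open>\<epsilon>(p) (sign p)\<^bsup>d-1\<^esup> = sign p\<close>, which
  the weight \<open>1\<close> achieves for even \<open>d\<close> and the sign for odd \<open>d\<close>, whence the two cases
  (lemma \<open>bracket_expansion_eq_signed_sum\<close>).

  The formulation with formal linear combinations follows because extending a function
  linearly commutes with finite sums (lemma \<open>linear_extension_dual_tableau_poly\<close>).
\<close>

section \<open>Signed sums over row permutations\<close>

lemma bracket_eq_sum_permutes: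
  "bracket R = (\<Sum>p | p permutes UNIV. of_int (sign p) * (\<Prod>k\<in>UNIV. R $ p k $ k))"
  by (simp add: bracket_def det_def)

lemma prod_list_vec_nth: "prod_list vs $ k = (\<Prod>v\<leftarrow>vs. v $ k)"
  by (induction vs) auto

lemma hadamard_matrix_nth: "hadamard_matrix Y $ k $ j = (\<Prod>R\<leftarrow>Y. R $ j $ k)"
  by (simp add: hadamard_matrix_def hadamard_column_def prod_list_vec_nth comp_def)

lemma permute_row_nth [simp]: "permute_row \<sigma> R $ j = R $ \<sigma> j"
  by (simp add: permute_row_def)

lemma permute_rows_Cons [simp]:
  "permute_rows (\<sigma> # \<sigma>s) (R # Y) = permute_row \<sigma> R # permute_rows \<sigma>s Y"
  by (simp add: permute_rows_def)

lemma permute_row_id [simp]: "permute_row id R = R"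
  by (simp add: vec_eq_iff)

lemma sum_lists_Suc_length:
  "(\<Sum>xs | xs \<in> lists A \<and> length xs = Suc n. f xs) =
     (\<Sum>x\<in>A. \<Sum>xs | xs \<in> lists A \<and> length xs = n. f (x # xs))"
proof -
  have eq: "{xs. xs \<in> lists A \<and> length xs = Suc n} =
      (\<lambda>(x, xs). x # xs) ` (A \<times> {xs. xs \<in> lists A \<and> length xs = n})"
    by (auto simp: length_Suc_conv image_iff)
  show ?thesis
    unfolding eq sum.cartesian_product
    by (subst sum.reindex) (auto simp: inj_on_def case_prod_beta)
qed

text \<open>
  Substituting \<open>\<tau> = \<sigma> \<circ> p\<close> turns the sum into the Leibniz expansion of the bracket; the
  signs differ by the factor \<open>sign p\<close> since \<open>sign \<tau> = sign \<sigma> * sign p\<close>.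
\<close>

lemma signed_sum_permuted_row:
  fixes R :: "('a::comm_ring_1, 'n::finite) row"
  assumes p: "p permutes UNIV"
  shows "(\<Sum>\<sigma> | \<sigma> permutes UNIV. of_int (sign \<sigma>) * (\<Prod>k\<in>UNIV. R $ \<sigma> (p k) $ k)) =
    of_int (sign p) * bracket R"
proof -
  have "of_int (sign \<sigma>) * (\<Prod>k\<in>UNIV. R $ \<sigma> (p k) $ k) =
      of_int (sign p) * (of_int (sign (\<sigma> \<circ> p)) * (\<Prod>k\<in>UNIV. R $ (\<sigma> \<circ> p) k $ k))"
    if "\<sigma> permutes UNIV" for \<sigma>
  proof -
    have "sign \<sigma> = sign p * sign (\<sigma> \<circ> p)"
      using p that by (simp add: sign_compose permutes_imp_permutation mult.left_commute)
    then have "(of_int (sign \<sigma>) :: 'a) = of_int (sign p) * of_int (sign (\<sigma> \<circ> p))"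
      by simp
    then show ?thesis
      by (simp add: mult.assoc)
  qed
  then have "(\<Sum>\<sigma> | \<sigma> permutes UNIV. of_int (sign \<sigma>) * (\<Prod>k\<in>UNIV. R $ \<sigma> (p k) $ k)) =
      of_int (sign p) * (\<Sum>\<sigma> | \<sigma> permutes UNIV.
        of_int (sign (\<sigma> \<circ> p)) * (\<Prod>k\<in>UNIV. R $ (\<sigma> \<circ> p) k $ k))"
    by (simp add: sum_distrib_left)
  also have "\<dots> = of_int (sign p) * bracket R"
    unfolding bracket_eq_sum_permutes
    by (subst sum_permutations_compose_right[OF p, symmetric]) (rule refl)
  finally show ?thesis .
qed

text \<open>
  The permutations of different rows are chosen independently, so the signed sum over
  all choices factors into one sum for each row, to which the previous lemma applies.
\<close>

lemma signed_sum_permuted_rows: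
  fixes Y :: "('a::comm_ring_1, 'n::finite) array"
  assumes p: "p permutes UNIV"
  shows "(\<Sum>\<sigma>s | \<sigma>s \<in> lists {\<sigma>. \<sigma> permutes UNIV} \<and> length \<sigma>s = length Y.
      of_int (sign_list \<sigma>s) * (\<Prod>k\<in>UNIV. \<Prod>R\<leftarrow>permute_rows \<sigma>s Y. R $ p k $ k)) =
    of_int (sign p) ^ length Y * bracket_expansion Y"
proof (induction Y)
  case Nil
  have "{\<sigma>s. \<sigma>s \<in> lists {\<sigma>. \<sigma> permutes (UNIV :: 'n set)} \<and> length \<sigma>s = 0} = {[]}"
    by auto
  then show ?case
    by (simp add: sign_list_def permute_rows_def bracket_expansion_def)
next
  case (Cons R Y)
  let ?P = "{\<sigma>. \<sigma> permutes (UNIV :: 'n set)}"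
  let ?L = "{\<sigma>s. \<sigma>s \<in> lists ?P \<and> length \<sigma>s = length Y}"
  let ?row = "\<lambda>\<sigma>. of_int (sign \<sigma>) * (\<Prod>k\<in>UNIV. R $ \<sigma> (p k) $ k)"
  let ?rows = "\<lambda>\<sigma>s. of_int (sign_list \<sigma>s) *
    (\<Prod>k\<in>UNIV. \<Prod>R\<leftarrow>permute_rows \<sigma>s Y. R $ p k $ k)"
  have "(\<Sum>\<sigma>s | \<sigma>s \<in> lists ?P \<and> length \<sigma>s = length (R # Y).
      of_int (sign_list \<sigma>s) * (\<Prod>k\<in>UNIV. \<Prod>R\<leftarrow>permute_rows \<sigma>s (R # Y). R $ p k $ k)) =
    (\<Sum>\<sigma>\<in>?P. \<Sum>\<sigma>s\<in>?L. ?row \<sigma> * ?rows \<sigma>s)"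
    by (simp add: sum_lists_Suc_length sign_list_def prod.distrib mult_ac)
  also have "\<dots> = (\<Sum>\<sigma>\<in>?P. ?row \<sigma>) * (\<Sum>\<sigma>s\<in>?L. ?rows \<sigma>s)"
    by (simp add: sum_product)
  also have "\<dots> = of_int (sign p) ^ length (R # Y) * bracket_expansion (R # Y)"
    by (simp add: signed_sum_permuted_row[OF p] Cons.IH bracket_expansion_def mult_ac)
  finally show ?case .
qed

section \<open>Bracket monomials as signed sums of dual brackets\<close>

text \<open>
  Permanent and determinant are treated together through the weight \<open>\<epsilon>\<close>. The rows after
  the first contribute \<open>sign p\<close> each, and the hypothesis on \<open>\<epsilon>\<close> says that these signs leave
  exactly the one that the bracket of the first row needs.
\<close>

lemma bracket_expansion_eq_signed_sum:
  fixes R :: "('a::comm_ring_1, 'n::finite) row"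
  assumes \<epsilon>: "\<And>p. p permutes (UNIV :: 'n set) \<Longrightarrow> \<epsilon> p * sign p ^ length Y = sign p"
    and f: "\<And>X. f X = (\<Sum>p | p permutes UNIV.
      of_int (\<epsilon> p) * (\<Prod>k\<in>UNIV. hadamard_matrix X $ k $ p k))"
  shows "bracket_expansion (R # Y) =
    (\<Sum>\<sigma>s\<in>perm_lists (length (R # Y)).
       of_int (sign_list \<sigma>s) * f (permute_rows (id # \<sigma>s) (R # Y)))"
proof -
  let ?P = "{p. p permutes (UNIV :: 'n set)}"
  let ?L = "{\<sigma>s. \<sigma>s \<in> lists ?P \<and> length \<sigma>s = length Y}"
  let ?first = "\<lambda>p. \<Prod>k\<in>UNIV. R $ p k $ k"
  let ?rows = "\<lambda>p \<sigma>s. of_int (sign_list \<sigma>s) *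
    (\<Prod>k\<in>UNIV. \<Prod>R\<leftarrow>permute_rows \<sigma>s Y. R $ p k $ k)"
  have "(\<Sum>\<sigma>s\<in>perm_lists (length (R # Y)).
       of_int (sign_list \<sigma>s) * f (permute_rows (id # \<sigma>s) (R # Y))) =
     (\<Sum>\<sigma>s\<in>?L. \<Sum>p\<in>?P. of_int (\<epsilon> p) * ?first p * ?rows p \<sigma>s)"
    by (simp add: perm_lists_def f hadamard_matrix_nth prod.distrib sum_distrib_left mult_ac)
  also have "\<dots> = (\<Sum>p\<in>?P. of_int (\<epsilon> p) * ?first p * (\<Sum>\<sigma>s\<in>?L. ?rows p \<sigma>s))"
    by (subst sum.swap) (simp add: sum_distrib_left)
  also have "\<dots> = (\<Sum>p\<in>?P. of_int (\<epsilon> p * sign p ^ length Y) * ?first p * bracket_expansion Y)"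
    by (intro sum.cong refl) (simp add: signed_sum_permuted_rows mult_ac)
  also have "\<dots> = (\<Sum>p\<in>?P. of_int (sign p) * ?first p) * bracket_expansion Y"
    by (simp add: \<epsilon> sum_distrib_right)
  also have "\<dots> = bracket_expansion (R # Y)"
    by (simp add: bracket_eq_sum_permutes bracket_expansion_def)
  finally show ?thesis by simp
qed

lemma sign_power_even: "even n \<Longrightarrow> sign p ^ n = 1"
  by (simp add: sign_def)

lemma bracket_expansion_eq_sum_even_dual_bracket:
  fixes Y :: "('a::comm_ring_1, 'n::finite) array"
  assumes "Y \<noteq> []" and "even (length Y)"
  shows "bracket_expansion Y = (\<Sum>\<sigma>s\<in>perm_lists (length Y).
    of_int (sign_list \<sigma>s) * even_dual_bracket (permute_rows (id # \<sigma>s) Y))"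
proof -
  obtain R Z where Y: "Y = R # Z"
    using assms(1) by (cases Y) auto
  have odd: "1 * sign p ^ length Z = sign p" for p :: "'n \<Rightarrow> 'n"
    using assms(2) by (auto simp: Y sign_def)
  show ?thesis
    unfolding Y
    by (rule bracket_expansion_eq_signed_sum[where \<epsilon> = "\<lambda>_. 1", OF odd])
      (simp add: even_dual_bracket_def permanent_def)
qed

lemma bracket_expansion_eq_sum_odd_dual_bracket:
  fixes Y :: "('a::comm_ring_1, 'n::finite) array"
  assumes "odd (length Y)"
  shows "bracket_expansion Y = (\<Sum>\<sigma>s\<in>perm_lists (length Y).
    of_int (sign_list \<sigma>s) * odd_dual_bracket (permute_rows (id # \<sigma>s) Y))"
proof -
  obtain R Z where Y: "Y = R # Z"
    using assms by (cases Y) auto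
  have even: "sign p * sign p ^ length Z = sign p" for p :: "'n \<Rightarrow> 'n"
    using assms by (simp add: Y sign_power_even)
  show ?thesis
    unfolding Y
    by (rule bracket_expansion_eq_signed_sum[where \<epsilon> = sign, OF even])
      (simp add: odd_dual_bracket_def det_def)
qed

section \<open>Linear extension to formal linear combinations\<close>

lemma const_poly_0 [simp]: "const_poly 0 = 0"
  by (simp add: const_poly_def)

lemma const_poly_add: "const_poly (a + b) = const_poly a + const_poly b"
  by (simp add: const_poly_def single_add)

lemma const_poly_of_int: "const_poly (of_int z) = of_int z"
  by (simp add: const_poly_def)

lemma linear_extension_eq_sum_superset:
  assumes "finite S" and "Poly_Mapping.keys c \<subseteq> S"
  shows "linear_extension f c = (\<Sum>t\<in>S. const_poly (Poly_Mapping.lookup c t) * f t)"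
  unfolding linear_extension_def
  by (rule sum.mono_neutral_left) (use assms in \<open>auto simp: in_keys_iff\<close>)

text \<open>
  The supports of \<open>c\<close>, \<open>e\<close> and \<open>c + e\<close> differ, and cancellation may shrink the last one, so
  all three sums are compared over the union of the first two supports.
\<close>

lemma linear_extension_add:
  "linear_extension f (c + e) = linear_extension f c + linear_extension f e"
proof -
  let ?S = "Poly_Mapping.keys c \<union> Poly_Mapping.keys e"
  have "linear_extension f x = (\<Sum>t\<in>?S. const_poly (Poly_Mapping.lookup x t) * f t)"
    if "Poly_Mapping.keys x \<subseteq> ?S" for x
    using that by (intro linear_extension_eq_sum_superset) auto
  then show ?thesis
    by (simp add: Poly_Mapping.keys_add lookup_add const_poly_add distrib_right sum.distrib)
qed

lemma linear_extension_sum: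
  "linear_extension f (\<Sum>i\<in>I. c i) = (\<Sum>i\<in>I. linear_extension f (c i))"
  by (induction I rule: infinite_finite_induct)
    (simp_all add: linear_extension_add, simp_all add: linear_extension_def)

lemma linear_extension_single:
  "linear_extension f (Poly_Mapping.single t a) = const_poly a * f t"
  by (simp add: linear_extension_def)

lemma linear_extension_dual_tableau_poly:
  "linear_extension f (dual_tableau_poly Y) =
    (\<Sum>\<sigma>s\<in>perm_lists (length Y). of_int (sign_list \<sigma>s) * f (permute_rows (id # \<sigma>s) Y))"
  by (simp add: dual_tableau_poly_def linear_extension_sum linear_extension_single
      const_poly_of_int)

section \<open>The expansion of a bracket monomial in dual brackets\<close>

theorem theorem2:
  fixes Y :: "(('k::field, 'm::finite, 'n::finite) coord_poly, 'n) array"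
    and d :: nat
  assumes "CHAR('k) \<noteq> 2"
    and "CARD('m) \<ge> CARD('n)"
    and "d \<ge> 1"
    and "young_tableau d Y"
  shows "bracket_expansion Y =
           (if even d then linear_extension even_dual_bracket (dual_tableau_poly Y)
            else linear_extension odd_dual_bracket (dual_tableau_poly Y)) \<and>
         bracket_expansion Y =
           (if even d
            then \<Sum>\<sigma>s\<in>perm_lists d.
                   of_int (sign_list \<sigma>s) * even_dual_bracket (permute_rows (id # \<sigma>s) Y)
            else \<Sum>\<sigma>s\<in>perm_lists d.
                   of_int (sign_list \<sigma>s) * odd_dual_bracket (permute_rows (id # \<sigma>s) Y))"
proof -
  have len: "length Y = d"
    using assms(4) by (simp add: young_tableau_def)
  then have "Y \<noteq> []"
    using assms(3) by auto
  then show ?thesis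
    using bracket_expansion_eq_sum_even_dual_bracket[of Y]
      bracket_expansion_eq_sum_odd_dual_bracket[of Y]
    by (simp add: len linear_extension_dual_tableau_poly)
qed

end
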